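(* Let $A,B$ be finite alphabets, let $\sigma\colon A^*\to B^*$ be a morphism and let $X\subseteq A^{\mathbb Z}$ be a shift space on $A$. 1. If $\sigma$ is one-sided recognizable on $X^+$, then it is recognizable on $X$. 2. If $\sigma$ is right-marked and is recognizable on $X$, then $\sigma$ is one-sided recognizable on $X^+$.
   Context: $S$ denotes the shift transformation, $S(x)_n=x_{n+1}$, on two-sided or one-sided sequences. A shift space on $A$ is a closed subset $X$ of $A^{\mathbb Z}$ with $S(X)=X$. For $x\in A^{\mathbb Z}$, $x^+=x_0x_1\cdots$, and $X^+=\{x^+\mid x\in X\}$. A morphism $\sigma\colon A^*\to B^*$ (possibly erasing letters) extends to sequences by concatenation: $\sigma(x)=\sigma(x_0)\sigma(x_1)\cdots$ for $x\in A^{\mathbb N}$, and $\sigma(x)=\cdots\sigma(x_{-1})\cdot\sigma(x_0)\sigma(x_1)\cdots$ for $x\in A^{\mathbb Z}$, with index $0$ at the beginning of $\sigma(x_0)\sigma(x_1)\cdots$. A $\sigma$-representation of $y\in B^{\mathbb Z}$ (resp. $y\in B^{\mathbb N}$) is a pair $(x,k)$ with $x\in A^{\mathbb Z}$ (resp. $x\in A^{\mathbb N}$), $0\le k<|\sigma(x_0)|$ and $y=S^k(\sigma(x))$. The morphism $\sigma$ is recognizable on $X$ if every $y\in B^{\mathbb Z}$ has at most one $\sigma$-representation $(x,k)$ with $x\in X$. It is one-sided recognizable on $X^+$ if every $y\in B^{\mathbb N}$ has at most one $\sigma$-representation $(x,k)$ with $x\in X^+$. A morphism $\sigma\colon A^*\to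 B^*$ is right-marked if it is non-erasing ($\sigma(a)$ is nonempty for every $a\in A$) and the words $\sigma(a)$, $a\in A$, end with different letters (i.e. distinct $a,a'\in A$ give words $\sigma(a),\sigma(a')$ with distinct last letters). *)

theory Defs
  imports "HOL-Analysis.Function_Topology"
begin

text \<open>
  Alphabets are finite types; words over \<open>'a\<close> are lists, one-sided sequences are functions
  \<open>nat \<Rightarrow> 'a\<close> and two-sided sequences are functions \<open>int \<Rightarrow> 'a\<close>.
\<close>

text \<open>The index type is \<open>nat\<close> for one-sided and \<open>int\<close> for two-sided sequences.\<close>

definition shift :: "('i::semiring_1 \<Rightarrow> 'a) \<Rightarrow> ('i \<Rightarrow> 'a)" where
  "shift x = (\<lambda>n. x (n + 1))"

text \<open>Closedness refers to the product of the discrete topologies on the alphabet.\<close>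

definition shift_space :: "(int \<Rightarrow> 'a) set \<Rightarrow> bool" where
  "shift_space X \<longleftrightarrow>
     closedin (product_topology (\<lambda>_::int. discrete_topology (UNIV :: 'a set)) UNIV) X \<and>
     shift ` X = X"

definition pos_part :: "(int \<Rightarrow> 'a) \<Rightarrow> (nat \<Rightarrow> 'a)" where
  "pos_part x = (\<lambda>n. x (int n))"

definition word_morphism :: "('a list \<Rightarrow> 'b list) \<Rightarrow> bool" where
  "word_morphism \<sigma> \<longleftrightarrow> \<sigma> [] = [] \<and> (\<forall>u v. \<sigma> (u @ v) = \<sigma> u @ \<sigma> v)"

text \<open>
  As \<open>\<sigma>\<close> may erase letters, the concatenation \<open>\<sigma>(x\<^sub>0)\<sigma>(x\<^sub>1)\<dots>\<close> may be a finite word. The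
  functions \<open>image_nat\<close> and \<open>image_int\<close> below give the sequence \<open>\<sigma>(x)\<close> only when the
  corresponding predicate \<open>infinite_image_nat\<close> or \<open>infinite_image_int\<close> holds; otherwise their
  values are irrelevant.
\<close>

definition infinite_image_nat :: "('a list \<Rightarrow> 'b list) \<Rightarrow> (nat \<Rightarrow> 'a) \<Rightarrow> bool" where
  "infinite_image_nat \<sigma> x \<longleftrightarrow> (\<forall>i. \<exists>n. i < length (\<sigma> (map x [0..<n])))"

text \<open>The letter of index \<open>i\<close> is read off a prefix \<open>\<sigma>(x\<^sub>0\<dots>x\<^sub>n\<^sub>-\<^sub>1)\<close> of length greater than \<open>i\<close>.\<close>

definition image_nat :: "('a list \<Rightarrow> 'b list) \<Rightarrow> (nat \<Rightarrow> 'a) \<Rightarrow> (nat \<Rightarrow> 'b)" where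
  "image_nat \<sigma> x = (\<lambda>i.
     let n = (LEAST n. i < length (\<sigma> (map x [0..<n])))
     in \<sigma> (map x [0..<n]) ! i)"

definition infinite_image_int :: "('a list \<Rightarrow> 'b list) \<Rightarrow> (int \<Rightarrow> 'a) \<Rightarrow> bool" where
  "infinite_image_int \<sigma> x \<longleftrightarrow>
     infinite_image_nat \<sigma> (pos_part x) \<and>
     (\<forall>i. \<exists>n. i < length (\<sigma> (map x [- int n..-1])))"

text \<open>
  For \<open>i < 0\<close>, the letter of index \<open>i\<close> is the \<open>-i\<close>-th letter from the end of a word
  \<open>\<sigma>(x\<^sub>-\<^sub>n\<dots>x\<^sub>-\<^sub>1)\<close> of length at least \<open>-i\<close>.
\<close>

definition image_int :: "('a list \<Rightarrow> 'b list) \<Rightarrow> (int \<Rightarrow> 'a) \<Rightarrow> (int \<Rightarrow> 'b)" where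
  "image_int \<sigma> x = (\<lambda>i.
     if 0 \<le> i then image_nat \<sigma> (pos_part x) (nat i)
     else let n = (LEAST n. nat (- i) \<le> length (\<sigma> (map x [- int n..-1])));
              w = \<sigma> (map x [- int n..-1])
          in w ! (length w - nat (- i)))"

definition representation_int ::
  "('a list \<Rightarrow> 'b list) \<Rightarrow> (int \<Rightarrow> 'b) \<Rightarrow> (int \<Rightarrow> 'a) \<times> nat \<Rightarrow> bool" where
  "representation_int \<sigma> y = (\<lambda>(x, k).
     k < length (\<sigma> [x 0]) \<and> infinite_image_int \<sigma> x \<and> y = (shift ^^ k) (image_int \<sigma> x))"

definition representation_nat ::
  "('a list \<Rightarrow> 'b list) \<Rightarrow> (nat \<Rightarrow> 'b) \<Rightarrow> (nat \<Rightarrow> 'a) \<times> nat \<Rightarrow> bool" where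
  "representation_nat \<sigma> y = (\<lambda>(x, k).
     k < length (\<sigma> [x 0]) \<and> infinite_image_nat \<sigma> x \<and> y = (shift ^^ k) (image_nat \<sigma> x))"

definition recognizable_on :: "('a list \<Rightarrow> 'b list) \<Rightarrow> (int \<Rightarrow> 'a) set \<Rightarrow> bool" where
  "recognizable_on \<sigma> X \<longleftrightarrow>
     (\<forall>y. \<exists>\<^sub>\<le>\<^sub>1p. fst p \<in> X \<and> representation_int \<sigma> y p)"

definition one_sided_recognizable_on :: "('a list \<Rightarrow> 'b list) \<Rightarrow> (nat \<Rightarrow> 'a) set \<Rightarrow> bool" where
  "one_sided_recognizable_on \<sigma> Y \<longleftrightarrow>
     (\<forall>y. \<exists>\<^sub>\<le>\<^sub>1p. fst p \<in> Y \<and> representation_nat \<sigma> y p)"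

definition right_marked :: "('a list \<Rightarrow> 'b list) \<Rightarrow> bool" where
  "right_marked \<sigma> \<longleftrightarrow>
     (\<forall>a. \<sigma> [a] \<noteq> []) \<and> (\<forall>a a'. a \<noteq> a' \<longrightarrow> last (\<sigma> [a]) \<noteq> last (\<sigma> [a']))"

end

theory Submission
  imports Defs "HOL-Library.Diagonal_Subsequence"
begin

text \<open>
  Let \<open>c\<^sub>j(x)\<close> be the index at which the block \<open>\<sigma>(x\<^sub>j)\<close> starts in \<open>\<sigma>(x)\<close>; moving the origin of
  \<open>\<sigma>(x)\<close> to \<open>c\<^sub>j(x)\<close> amounts to moving the origin of \<open>x\<close> to \<open>j\<close>.

  For the first claim, two two-sided representations of a point have the same index and agree on the
  right. Cutting the point at the start of a nonempty block far to the left gives two one-sided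
  representations, hence \<open>x\<^sub>m\<^sub>+\<^sub>n = x'\<^sub>m\<^sub>'\<^sub>+\<^sub>n\<close> for all \<open>n \<ge> 0\<close>. Here \<open>m = m'\<close>, as otherwise a copy of the
  nonempty block \<open>\<sigma>(x\<^sub>0)\<close> would fit into an empty part of the image.

  For the second claim, a block start common to two one-sided representations propagates to the left,
  as the letter before it determines the preceding block. So it suffices that almost all block starts
  of one of them are common to both. Otherwise, moving the origin to block starts that are not common
  and passing to the limit gives a point of \<open>B\<^sup>\<int>\<close> with two representations, one of index zero
  and one of positive index.
\<close>

section \<open>Block starts in the image of a two-sided sequence\<close>

text \<open>Allows negative \<open>m\<close>, since the origin must also be moved to the left; the
  powers of \<open>shift\<close> used in representations only move it to the right.\<close>

definition translate :: "int \<Rightarrow> (int \<Rightarrow> 'a) \<Rightarrow> (int \<Rightarrow> 'a)" where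
  "translate m x = (\<lambda>n. x (n + m))"

lemma translate_apply: "translate m x n = x (n + m)"
  by (simp add: translate_def)

lemma funpow_shift: "(shift ^^ k) x = (\<lambda>n. x (n + of_nat k))"
  by (induction k) (auto simp: shift_def add_ac)

text \<open>Steps to the right use that \<open>shift\<close> maps \<open>X\<close> into itself.
  Steps to the left use that it maps onto \<open>X\<close>: the preimage found there is forced,
  because \<open>shift\<close> is injective on two-sided sequences.\<close>

lemma shift_space_translate:
  assumes "shift_space X" "x \<in> X"
  shows "translate m x \<in> X"
proof (induction m rule: int_induct[where k = 0])
  case base
  then show ?case using assms(2) by (simp add: translate_def)
next
  case (step1 i)
  have "translate (i + 1) x = shift (translate i x)"
    by (auto simp: shift_def translate_apply add_ac)
  then show ?case using step1 assms(1) by (auto simp: shift_space_def)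
next
  case (step2 i)
  then obtain z where z: "z \<in> X" "translate i x = shift z"
    using assms(1) unfolding shift_space_def by blast
  have "z n = translate (i - 1) x n" for n
    using fun_cong[OF z(2), of "n - 1"] by (simp add: shift_def translate_apply algebra_simps)
  then have "z = translate (i - 1) x" by blast
  then show ?case using z(1) by simp
qed

text \<open>Closedness in usable form: a basic open set of the product topology restricts only
  finitely many coordinates, so a point outside \<open>X\<close> differs from all of
  \<open>X\<close> on some finite set.\<close>

lemma shift_space_memI:
  assumes "shift_space X" and approx: "\<And>J. finite J \<Longrightarrow> \<exists>u\<in>X. \<forall>i\<in>J. u i = z i"
  shows "z \<in> X"
proof (rule ccontr)
  assume "z \<notin> X"
  have "openin (product_topology (\<lambda>_::int. discrete_topology UNIV) UNIV) (- X)"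
    using assms(1) by (auto simp: shift_space_def closedin_def Compl_eq_Diff_UNIV)
  then have "\<forall>u\<in>- X. \<exists>U. finite {i. U i \<noteq> UNIV} \<and> u \<in> Pi\<^sub>E UNIV U \<and> Pi\<^sub>E UNIV U \<subseteq> - X"
    by (simp add: openin_product_topology_alt)
  with \<open>z \<notin> X\<close> obtain U
    where U: "finite {i. U i \<noteq> UNIV}" "z \<in> Pi\<^sub>E UNIV U" "Pi\<^sub>E UNIV U \<subseteq> - X"
    by blast
  obtain u where u: "u \<in> X" "\<forall>i\<in>{i. U i \<noteq> UNIV}. u i = z i"
    using approx[OF U(1)] by blast
  have "u i \<in> U i" for i
    using u(2) U(2) by (cases "U i = UNIV") (auto simp: PiE_iff)
  then have "u \<in> Pi\<^sub>E UNIV U" by auto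
  with U(3) u(1) show False by blast
qed

text \<open>At most one of the two intervals is nonempty.\<close>

definition block_start :: "('a list \<Rightarrow> 'b list) \<Rightarrow> (int \<Rightarrow> 'a) \<Rightarrow> int \<Rightarrow> int" where
  "block_start \<sigma> x j =
     int (length (\<sigma> (map x [0..j - 1]))) - int (length (\<sigma> (map x [j..-1])))"

lemma map_pos_part: "map (pos_part x) [0..<n] = map x [0..int n - 1]"
  by (induction n) (simp_all add: pos_part_def upto_rec2)

section \<open>Arbitrary morphisms: letters of the image in terms of block starts\<close>

context
  fixes \<sigma> :: "'a list \<Rightarrow> 'b list"
  assumes morphism: "word_morphism \<sigma>"
begin

lemma morphism_Nil [simp]: "\<sigma> [] = []"
  and morphism_append: "\<sigma> (u @ v) = \<sigma> u @ \<sigma> v"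
  using morphism by (auto simp: word_morphism_def)

lemma morphism_Cons: "\<sigma> (a # v) = \<sigma> [a] @ \<sigma> v"
  using morphism_append[of "[a]" v] by simp

lemma block_start_0 [simp]: "block_start \<sigma> x 0 = 0"
  by (simp add: block_start_def)

text \<open>Together with the value at 0, this recurrence determines \<open>block_start\<close> on
  all integers and hides the case split on the sign of \<open>j\<close>.\<close>

lemma block_start_step:
  "block_start \<sigma> x (j + 1) = block_start \<sigma> x j + int (length (\<sigma> [x j]))"
proof (cases "j \<ge> 0")
  case True
  then have "[0..j] = [0..j - 1] @ [j]" by (simp add: upto_rec2)
  then show ?thesis using True by (simp add: block_start_def morphism_append)
next
  case False
  then have "[j..-1] = j # [j + 1..-1]" by (simp add: upto_rec1)
  then show ?thesis
    using False by (simp add: block_start_def morphism_Cons[of _ "map _ _"])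
qed

lemma block_start_mono: "i \<le> j \<Longrightarrow> block_start \<sigma> x i \<le> block_start \<sigma> x j"
  by (induction j rule: int_ge_induct) (auto simp: block_start_step)

text \<open>Cocycle identity behind every change of origin: both sides agree at \<open>i = 0\<close>
  and have the same increments in \<open>i\<close>.\<close>

lemma block_start_add:
  "block_start \<sigma> x (m + i) = block_start \<sigma> x m + block_start \<sigma> (translate m x) i"
proof (induction i rule: int_induct[where k = 0])
  case base
  then show ?case by simp
next
  case (step1 i)
  have "translate m x i = x (m + i)" by (simp add: translate_apply add_ac)
  then show ?case
    using step1 block_start_step[of x "m + i"] block_start_step[of "translate m x" i]
    by (simp add: add_ac)
next
  case (step2 i)
  have "translate m x (i - 1) = x (m + (i - 1))" by (simp add: translate_apply add_ac)
  then show ?case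
    using step2 block_start_step[of x "m + (i - 1)"] block_start_step[of "translate m x" "i - 1"]
    by (simp add: add_ac)
qed

lemma block_start_cong:
  assumes "\<And>i. min 0 j \<le> i \<Longrightarrow> i < max 0 j \<Longrightarrow> x i = x' i"
  shows "block_start \<sigma> x j = block_start \<sigma> x' j"
proof -
  have "map x [0..j - 1] = map x' [0..j - 1]" "map x [j..-1] = map x' [j..-1]"
    using assms by auto
  then show ?thesis by (simp only: block_start_def)
qed

text \<open>Eliminates the \<open>LEAST\<close> of the definition: images of prefixes are nested, so
  every long enough prefix shows the same letter.\<close>

lemma image_nat_eq:
  assumes "i < length (\<sigma> (map u [0..<n]))"
  shows "image_nat \<sigma> u i = \<sigma> (map u [0..<n]) ! i"
proof -
  define m where "m = (LEAST m. i < length (\<sigma> (map u [0..<m])))"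
  have m: "i < length (\<sigma> (map u [0..<m]))" and "m \<le> n"
    using assms unfolding m_def by (auto intro: LeastI Least_le)
  then have "[0..<n] = [0..<m] @ [m..<n]"
    using upt_add_eq_append[of 0 m "n - m"] by simp
  then have "\<sigma> (map u [0..<n]) = \<sigma> (map u [0..<m]) @ \<sigma> (map u [m..<n])"
    by (simp add: morphism_append)
  then have "\<sigma> (map u [0..<n]) ! i = \<sigma> (map u [0..<m]) ! i"
    using m by (simp add: nth_append)
  then show ?thesis by (simp add: image_nat_def m_def Let_def)
qed

lemma image_int_of_nat: "image_int \<sigma> x (int i) = image_nat \<sigma> (pos_part x) i"
  by (simp add: image_int_def)

text \<open>Longer words extend the image to the left only, so a letter counted from the right end
  does not depend on the word chosen.\<close>

lemma image_int_neg_eq: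
  assumes "p < 0" "nat (- p) \<le> length (\<sigma> (map x [- int n..-1]))"
  shows "image_int \<sigma> x p
    = \<sigma> (map x [- int n..-1]) ! (length (\<sigma> (map x [- int n..-1])) - nat (- p))"
proof -
  define m where "m = (LEAST m. nat (- p) \<le> length (\<sigma> (map x [- int m..-1])))"
  have m: "nat (- p) \<le> length (\<sigma> (map x [- int m..-1]))" and "m \<le> n"
    using assms(2) unfolding m_def by (auto intro: LeastI Least_le)
  \<comment> \<open>For \<open>m = 0\<close> the word would be empty, but \<open>nat (- p)\<close>
    is positive; the interval can then be split before \<open>- int m\<close>.\<close>
  moreover from m assms(1) have "m \<ge> 1" by (cases m) auto
  ultimately have "[- int n..-1] = [- int n..- int m - 1] @ [- int m..-1]"
    by (intro upto_split1) auto
  then have *: "\<sigma> (map x [- int n..-1])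
      = \<sigma> (map x [- int n..- int m - 1]) @ \<sigma> (map x [- int m..-1])"
    by (simp only: map_append morphism_append)
  have "image_int \<sigma> x p
    = \<sigma> (map x [- int m..-1]) ! (length (\<sigma> (map x [- int m..-1])) - nat (- p))"
    using assms(1) by (simp add: image_int_def m_def Let_def)
  then show ?thesis using m by (simp add: * nth_append)
qed

lemma image_int_block:
  assumes "i < length (\<sigma> [x j])"
  shows "image_int \<sigma> x (block_start \<sigma> x j + int i) = \<sigma> [x j] ! i"
proof (cases "j \<ge> 0")
  case True
  define n where "n = nat j"
  let ?u = "pos_part x"
  have "map ?u [0..<Suc n] = map ?u [0..<n] @ [x j]"
    using True by (simp add: pos_part_def n_def)
  then have *: "\<sigma> (map ?u [0..<Suc n]) = \<sigma> (map ?u [0..<n]) @ \<sigma> [x j]"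
    by (simp only: morphism_append)
  have "block_start \<sigma> x j = int (length (\<sigma> (map ?u [0..<n])))"
    using True by (simp add: block_start_def map_pos_part n_def)
  then have "image_int \<sigma> x (block_start \<sigma> x j + int i)
    = image_nat \<sigma> ?u (length (\<sigma> (map ?u [0..<n])) + i)"
    by (metis image_int_of_nat of_nat_add)
  also have "\<dots> = \<sigma> [x j] ! i"
    using assms image_nat_eq[of "length (\<sigma> (map ?u [0..<n])) + i" ?u "Suc n"]
    unfolding * by simp
  finally show ?thesis .
next
  case False
  define n where "n = nat (- j)"
  have n: "j = - int n" using False by (simp add: n_def)
  let ?w = "\<sigma> (map x [- int n..-1])" and ?v = "\<sigma> (map x [j + 1..-1])"
  have "[j..-1] = j # [j + 1..-1]" using False by (simp add: upto_rec1)
  then have w: "?w = \<sigma> [x j] @ ?v"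
    using n by (simp add: morphism_Cons[of _ "map _ _"])
  have p: "block_start \<sigma> x j = - int (length ?w)"
    using False n by (simp add: block_start_def)
  have "image_int \<sigma> x (block_start \<sigma> x j + int i)
    = ?w ! (length ?w - nat (- (block_start \<sigma> x j + int i)))"
    using assms by (intro image_int_neg_eq) (auto simp: p w)
  also have "length ?w - nat (- (block_start \<sigma> x j + int i)) = i"
    using assms unfolding p w by simp
  finally show ?thesis using assms by (simp add: w nth_append)
qed

text \<open>By monotonicity, letting \<open>j\<close> range over all integers changes nothing, and
  the condition becomes easy to carry through translations.\<close>

lemma infinite_image_nat_iff:
  "infinite_image_nat \<sigma> (pos_part x) \<longleftrightarrow> (\<forall>p. \<exists>j. p < block_start \<sigma> x j)"
proof -
  have *: "block_start \<sigma> x (int n) = int (length (\<sigma> (map (pos_part x) [0..<n])))" for n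
    by (simp add: block_start_def map_pos_part)
  show ?thesis
  proof
    assume inf: "infinite_image_nat \<sigma> (pos_part x)"
    show "\<forall>p. \<exists>j. p < block_start \<sigma> x j"
    proof
      fix p
      obtain n where "nat p < length (\<sigma> (map (pos_part x) [0..<n]))"
        using inf unfolding infinite_image_nat_def by blast
      then show "\<exists>j. p < block_start \<sigma> x j"
        by (intro exI[of _ "int n"]) (simp add: *)
    qed
  next
    assume unbounded: "\<forall>p. \<exists>j. p < block_start \<sigma> x j"
    show "infinite_image_nat \<sigma> (pos_part x)"
      unfolding infinite_image_nat_def
    proof
      fix i
      obtain j where j: "int i < block_start \<sigma> x j" using unbounded by blast
      also have "\<dots> \<le> block_start \<sigma> x (int (nat j))" by (intro block_start_mono) simp
      finally show "\<exists>n. i < length (\<sigma> (map (pos_part x) [0..<n]))"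
        unfolding * by auto
    qed
  qed
qed

lemma infinite_image_int_iff:
  "infinite_image_int \<sigma> x \<longleftrightarrow>
     (\<forall>p. \<exists>j. p < block_start \<sigma> x j) \<and> (\<forall>p. \<exists>j. block_start \<sigma> x j \<le> p)"
proof -
  have *: "block_start \<sigma> x (- int n) = - int (length (\<sigma> (map x [- int n..-1])))" for n
    by (simp add: block_start_def)
  have "(\<forall>i. \<exists>n. i < length (\<sigma> (map x [- int n..-1]))) \<longleftrightarrow> (\<forall>p. \<exists>j. block_start \<sigma> x j \<le> p)"
  proof
    assume inf: "\<forall>i. \<exists>n. i < length (\<sigma> (map x [- int n..-1]))"
    show "\<forall>p. \<exists>j. block_start \<sigma> x j \<le> p"
    proof
      fix p
      obtain n where "nat (- p) < length (\<sigma> (map x [- int n..-1]))" using inf by blast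
      then show "\<exists>j. block_start \<sigma> x j \<le> p"
        by (intro exI[of _ "- int n"]) (simp add: *)
    qed
  next
    assume unbounded: "\<forall>p. \<exists>j. block_start \<sigma> x j \<le> p"
    show "\<forall>i. \<exists>n. i < length (\<sigma> (map x [- int n..-1]))"
    proof
      fix i
      obtain j where "block_start \<sigma> x j \<le> - int i - 1" using unbounded by blast
      moreover have "block_start \<sigma> x (- int (nat (- j))) \<le> block_start \<sigma> x j"
        by (intro block_start_mono) simp
      ultimately have "i < length (\<sigma> (map x [- int (nat (- j))..-1]))"
        unfolding * by linarith
      then show "\<exists>n. i < length (\<sigma> (map x [- int n..-1]))" by blast
    qed
  qed
  then show ?thesis by (simp add: infinite_image_int_def infinite_image_nat_iff)
qed

text \<open>The block is the last one starting at or before \<open>p\<close>; empty blocks starting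
  there are thereby skipped.\<close>

lemma block_cover:
  assumes inf: "infinite_image_nat \<sigma> (pos_part x)" and "block_start \<sigma> x j0 \<le> p"
  obtains j i where "j \<ge> j0" "i < length (\<sigma> [x j])" "p = block_start \<sigma> x j + int i"
proof -
  define P where "P n \<longleftrightarrow> p < block_start \<sigma> x (j0 + int n)" for n
  obtain j1 where j1: "p < block_start \<sigma> x j1" using inf infinite_image_nat_iff by blast
  have "j0 \<le> j1"
    using j1 assms(2) block_start_mono[of j1 j0 x] by linarith
  then have "P (nat (j1 - j0))" using j1 by (simp add: P_def)
  moreover have "\<not> P 0" using assms(2) by (simp add: P_def)
  ultimately obtain n where n: "\<not> P n" "P (Suc n)"
    using ex_least_nat_less[of P] by blast
  have "block_start \<sigma> x (j0 + int (Suc n))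
      = block_start \<sigma> x (j0 + int n) + int (length (\<sigma> [x (j0 + int n)]))"
    using block_start_step[of x "j0 + int n"] by (simp add: add_ac)
  then show ?thesis
    using n by (intro that[of "j0 + int n" "nat (p - block_start \<sigma> x (j0 + int n))"])
      (auto simp: P_def)
qed

text \<open>The position lies in some block, whose letters are the same in both images. The bound by
  \<open>j0\<close> guarantees this block when the image to the left may be finite.\<close>

lemma image_int_translate:
  assumes inf: "infinite_image_nat \<sigma> (pos_part x)" and "block_start \<sigma> x j0 \<le> p + block_start \<sigma> x m"
  shows "image_int \<sigma> (translate m x) p = image_int \<sigma> x (p + block_start \<sigma> x m)"
proof -
  obtain j i where j: "i < length (\<sigma> [x j])" "p + block_start \<sigma> x m = block_start \<sigma> x j + int i"
    using block_cover[OF assms] by metis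
  have p: "p = block_start \<sigma> (translate m x) (j - m) + int i"
    using j(2) block_start_add[of x m "j - m"] by simp
  then show ?thesis
    using j image_int_block[of i "translate m x" "j - m"] image_int_block[of i x j]
    unfolding j(2) by (simp add: translate_apply flip: p)
qed

lemma infinite_image_nat_translate:
  assumes "infinite_image_nat \<sigma> (pos_part x)"
  shows "infinite_image_nat \<sigma> (pos_part (translate m x))"
  unfolding infinite_image_nat_iff
proof
  fix p
  obtain j where "p + block_start \<sigma> x m < block_start \<sigma> x j"
    using assms infinite_image_nat_iff by blast
  then show "\<exists>j. p < block_start \<sigma> (translate m x) j"
    using block_start_add[of x m "j - m"] by (intro exI[of _ "j - m"]) simp
qed

text \<open>Expresses one-sided representations through \<open>image_int\<close>, so that both
  claims are argued with block starts of two-sided sequences.\<close>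

lemma representation_nat_pos_part:
  "representation_nat \<sigma> y (pos_part x, k) \<longleftrightarrow>
     k < length (\<sigma> [x 0]) \<and> infinite_image_nat \<sigma> (pos_part x) \<and>
     (\<forall>n. y n = image_int \<sigma> x (int n + int k))"
  using image_int_of_nat[of x "_ + k"]
  by (auto simp: representation_nat_def funpow_shift fun_eq_iff pos_part_def)

lemma representation_int_iff:
  "representation_int \<sigma> y (x, k) \<longleftrightarrow>
     k < length (\<sigma> [x 0]) \<and> infinite_image_int \<sigma> x \<and>
     (\<forall>n. y n = image_int \<sigma> x (n + int k))"
  by (auto simp: representation_int_def funpow_shift fun_eq_iff)

section \<open>From one-sided to two-sided recognizability\<close>

text \<open>If \<open>d > 0\<close>, the letter \<open>x (- d) = x 0\<close> has a nonempty image
  squeezed between the starts of blocks \<open>- d\<close> and 0, which are both 0.\<close>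

lemma recurrent_block_offset:
  assumes ext: "\<And>n. n \<ge> 0 \<Longrightarrow> x (n - d) = x' n" and "x' 0 = x 0" and "\<sigma> [x 0] \<noteq> []"
    and "block_start \<sigma> x (- d) = 0"
  shows "d \<le> 0"
proof (rule ccontr)
  assume "\<not> d \<le> 0"
  then have "block_start \<sigma> x (- d + 1) \<le> block_start \<sigma> x 0" by (intro block_start_mono) simp
  moreover have "x (- d) = x 0" using ext[of 0] assms(2) by simp
  ultimately show False using block_start_step[of x "- d"] assms(3,4) by simp
qed

lemma recognizable_of_one_sided:
  assumes shift: "shift_space X" and one_sided: "one_sided_recognizable_on \<sigma> (pos_part ` X)"
  shows "recognizable_on \<sigma> X"
proof -
  have unique: "k = k' \<and> pos_part x = pos_part x'"
    if "x \<in> X" "x' \<in> X" "representation_nat \<sigma> y (pos_part x, k)"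
      "representation_nat \<sigma> y (pos_part x', k')" for x x' y k k'
    using one_sided that unfolding one_sided_recognizable_on_def Uniq_def
    by (metis fst_conv imageI prod.inject)
  have "x = x' \<and> k = k'"
    if X: "x \<in> X" "x' \<in> X" and rep: "representation_int \<sigma> y (x, k)" "representation_int \<sigma> y (x', k')"
    for x x' y k k'
  proof -
    note R = rep[unfolded representation_int_iff]
    have inf: "infinite_image_nat \<sigma> (pos_part x)" "infinite_image_nat \<sigma> (pos_part x')"
      using R by (auto simp: infinite_image_int_def)
    have "representation_nat \<sigma> (pos_part y) (pos_part x, k)"
      "representation_nat \<sigma> (pos_part y) (pos_part x', k')"
      using R inf by (auto simp: representation_nat_pos_part) (auto simp: pos_part_def)
    then have k: "k = k'" and pos: "pos_part x = pos_part x'"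
      using unique X by blast+
    have nonneg: "x j = x' j" if "j \<ge> 0" for j
      using fun_cong[OF pos, of "nat j"] that by (simp add: pos_part_def)
    have img: "image_int \<sigma> x p = image_int \<sigma> x' p" for p
      using R k by (metis diff_add_cancel)
    have "x j = x' j" if j: "j < 0" for j
    proof -
      \<comment> \<open>Blocks just before \<open>j\<close> may be empty, so the cut is made at the
        nonempty block \<open>m\<close> covering the position left of the start of block
        \<open>j\<close>.\<close>
      obtain j0 where "block_start \<sigma> x j0 \<le> block_start \<sigma> x j - 1"
        using R(1) infinite_image_int_iff by blast
      then obtain m i where m: "i < length (\<sigma> [x m])" "block_start \<sigma> x j - 1 = block_start \<sigma> x m + int i"
        using block_cover[OF inf(1)] by metis
      define p where "p = block_start \<sigma> x m"
      have "m < j"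
        using m(2) block_start_mono[of j m x] by linarith
      obtain j0' where "block_start \<sigma> x' j0' \<le> p"
        using R(2) infinite_image_int_iff by blast
      then obtain m' l where m': "l < length (\<sigma> [x' m'])" "p = block_start \<sigma> x' m' + int l"
        using block_cover[OF inf(2)] by metis
      \<comment> \<open>The point cut at \<open>p\<close>. It has index 0 with respect to
        \<open>x\<close> and \<open>l\<close> with respect to \<open>x'\<close>; uniqueness forces
        \<open>l = 0\<close> and aligns the letters from \<open>m\<close> and \<open>m'\<close>
        on.\<close>
      define y' where "y' n = image_int \<sigma> x (p + int n)" for n
      have "representation_nat \<sigma> y' (pos_part (translate m x), 0)"
        unfolding representation_nat_pos_part
      proof (intro conjI allI)
        show "y' n = image_int \<sigma> (translate m x) (int n + int 0)" for n
          using image_int_translate[OF inf(1), of m "int n" m] by (simp add: y'_def p_def add_ac)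
      qed (use m inf infinite_image_nat_translate in \<open>auto simp: translate_apply\<close>)
      moreover have "representation_nat \<sigma> y' (pos_part (translate m' x'), l)"
        unfolding representation_nat_pos_part
      proof (intro conjI allI)
        show "y' n = image_int \<sigma> (translate m' x') (int n + int l)" for n
          using image_int_translate[OF inf(2), of m' "int n + int l" m'] m'(2)
          by (simp add: y'_def img add_ac)
      qed (use m' inf infinite_image_nat_translate in \<open>auto simp: translate_apply\<close>)
      ultimately have l: "l = 0" and eq: "pos_part (translate m x) = pos_part (translate m' x')"
        using unique shift_space_translate[OF shift] X by blast+
      have shifted: "x (n + m) = x' (n + m')" if "n \<ge> 0" for n
        using fun_cong[OF eq, of "nat n"] that by (simp add: pos_part_def translate_apply)
      have "block_start \<sigma> (translate m x) n = block_start \<sigma> (translate m' x') n" if "n \<ge> 0" for n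
        using that shifted by (intro block_start_cong) (auto simp: translate_apply)
      then have starts: "block_start \<sigma> x (m + n) = block_start \<sigma> x' (m' + n)" if "n \<ge> 0" for n
        using that m'(2) l block_start_add[of x m n] block_start_add[of x' m' n]
        by (simp add: p_def)
      have "m < 0" using \<open>m < j\<close> j by simp
      \<comment> \<open>As \<open>l = 0\<close>, \<open>p\<close> is the start of block
        \<open>m'\<close> of \<open>x'\<close>, so \<open>m'\<close> is negative as well and
        \<open>- m'\<close> is an admissible argument of \<open>starts\<close>.\<close>
      have "p < 0"
        using m(2) block_start_mono[of j 0 x] j by (simp add: p_def)
      then have "m' < 0"
        using m'(2) l block_start_mono[of 0 m' x'] by (cases "m' < 0") auto
      have x0: "\<sigma> [x 0] \<noteq> []" "x' 0 = x 0" using R(1) nonneg by auto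
      \<comment> \<open>Taking \<open>n = - m'\<close> in \<open>starts\<close> compares with block
        0 of \<open>x'\<close>, which starts at 0. The opposite inequality follows by exchanging the
        roles of \<open>x\<close> and \<open>x'\<close>.\<close>
      have "m' - m \<le> 0"
      proof (rule recurrent_block_offset[of x _ x'])
        show "x (n - (m' - m)) = x' n" if "n \<ge> 0" for n
          using shifted[of "n - m'"] that \<open>m' < 0\<close> by (simp add: algebra_simps)
        show "block_start \<sigma> x (- (m' - m)) = 0"
          using starts[of "- m'"] \<open>m' < 0\<close> by simp
      qed (use x0 in auto)
      moreover have "m - m' \<le> 0"
      proof (rule recurrent_block_offset[of x' _ x])
        show "x' (n - (m - m')) = x n" if "n \<ge> 0" for n
          using shifted[of "n - m"] that \<open>m < 0\<close> by (simp add: algebra_simps)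
        show "block_start \<sigma> x' (- (m - m')) = 0"
          using starts[of "- m"] \<open>m < 0\<close> by simp
      qed (use x0 in auto)
      ultimately have "m = m'" by simp
      then show ?thesis using shifted[of "j - m"] \<open>m < j\<close> by simp
    qed
    then have "x j = x' j" for j using nonneg by (cases "j \<ge> 0") auto
    then show ?thesis using k by auto
  qed
  then show ?thesis
    unfolding recognizable_on_def Uniq_def by (metis prod.collapse)
qed

end

section \<open>From two-sided to one-sided recognizability\<close>

text \<open>Sequential compactness of a countable product of finite sets, by a diagonal argument:
  \<open>P m s\<close> makes coordinate number \<open>m\<close> constant along
  \<open>s\<close>.\<close>

lemma pointwise_convergent_subsequence:
  fixes f :: "nat \<Rightarrow> 'i::countable \<Rightarrow> 'c"
  assumes fin: "\<And>i. finite (range (\<lambda>n. f n i))"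
  obtains s g where "strict_mono s" "\<And>i. \<forall>\<^sub>F n in sequentially. f (s n) i = g i"
proof -
  define P where "P m s \<longleftrightarrow> (\<exists>c. \<forall>n. f (s n) (from_nat m) = c)" for m and s :: "nat \<Rightarrow> nat"
  interpret subseqs P
  proof
    fix m and s :: "nat \<Rightarrow> nat"
    assume "strict_mono s"
    have "finite (range (\<lambda>n. f (s n) (from_nat m)))"
      by (rule finite_subset[OF _ fin[of "from_nat m"]]) auto
    then obtain n0 where "infinite {n. f (s n) (from_nat m) = f (s n0) (from_nat m)}"
      using pigeonhole_infinite[of UNIV "\<lambda>n. f (s n) (from_nat m)"] by auto
    then obtain r :: "nat \<Rightarrow> nat" where "strict_mono r"
      "\<And>n. r n \<in> {n. f (s n) (from_nat m) = f (s n0) (from_nat m)}"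
      using infinite_enumerate by blast
    then show "\<exists>r. strict_mono r \<and> P m (s \<circ> r)"
      unfolding P_def by auto
  qed
  have "\<exists>c. \<forall>\<^sub>F n in sequentially. f (diagseq n) i = c" for i
  proof -
    \<comment> \<open>The diagonal sequence refines the one chosen for coordinate \<open>i\<close>
      only from this index on, hence the eventual equality.\<close>
    have "P (to_nat i) (diagseq \<circ> (+) (Suc (to_nat i)))"
      by (rule diagseq_holds) (auto simp: P_def)
    then obtain c where "f (diagseq (Suc (to_nat i) + n)) i = c" for n
      by (auto simp: P_def)
    then have "\<forall>n\<ge>Suc (to_nat i). f (diagseq n) i = c"
      by (metis le_add_diff_inverse)
    then show ?thesis unfolding eventually_sequentially by blast
  qed
  then obtain g where "\<forall>\<^sub>F n in sequentially. f (diagseq n) i = g i" for i by metis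
  then show ?thesis using that subseq_diagseq by blast
qed

section \<open>Right-marked morphisms: strictly increasing block starts and continuity of the
  image\<close>

context
  fixes \<sigma> :: "'a list \<Rightarrow> 'b list"
  assumes morphism: "word_morphism \<sigma>" and marked: "right_marked \<sigma>"
begin

lemma nonerasing [simp]: "\<sigma> [a] \<noteq> []"
  using marked by (simp add: right_marked_def)

lemma block_start_step_ge: "block_start \<sigma> x j + 1 \<le> block_start \<sigma> x (j + 1)"
  using block_start_step[OF morphism, of x j] nonerasing[of "x j"]
  by (simp add: Suc_le_eq)

lemma block_start_diff_ge: "i \<le> j \<Longrightarrow> block_start \<sigma> x i + (j - i) \<le> block_start \<sigma> x j"
proof (induction j rule: int_ge_induct)
  case (step j)
  then show ?case using block_start_step_ge[of x j] by linarith
qed simp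

lemma infinite_image_int_nonerasing: "infinite_image_int \<sigma> x"
  unfolding infinite_image_int_iff[OF morphism]
proof (intro conjI allI)
  fix p
  show "\<exists>j. p < block_start \<sigma> x j"
    using block_start_diff_ge[of 0 "max 0 p + 1" x] block_start_0[OF morphism, of x]
    by (intro exI[of _ "max 0 p + 1"]) simp
  show "\<exists>j. block_start \<sigma> x j \<le> p"
    using block_start_diff_ge[of "min 0 p" 0 x] block_start_0[OF morphism, of x]
    by (intro exI[of _ "min 0 p"]) simp
qed

lemma infinite_image_nat_nonerasing: "infinite_image_nat \<sigma> (pos_part x)"
  using infinite_image_int_nonerasing by (simp add: infinite_image_int_def)

lemma block_cover_nonerasing:
  obtains j i where "i < length (\<sigma> [x j])" "p = block_start \<sigma> x j + int i"
proof -
  obtain j0 where "block_start \<sigma> x j0 \<le> p"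
    using infinite_image_int_nonerasing infinite_image_int_iff[OF morphism] by blast
  then show ?thesis
    using block_cover[OF morphism infinite_image_nat_nonerasing] that by metis
qed

lemma image_int_translate_nonerasing:
  "image_int \<sigma> (translate m x) p = image_int \<sigma> x (p + block_start \<sigma> x m)"
proof -
  obtain j0 where "block_start \<sigma> x j0 \<le> p + block_start \<sigma> x m"
    using infinite_image_int_nonerasing infinite_image_int_iff[OF morphism] by blast
  then show ?thesis
    using image_int_translate[OF morphism infinite_image_nat_nonerasing] by blast
qed

text \<open>Continuity of the image: if \<open>p\<close> lies in block \<open>j\<close> of
  \<open>z\<close>, the letters between 0 and \<open>j\<close> inclusive fix both this block and
  where it starts.\<close>

lemma image_int_local:
  obtains J where "finite J" "\<And>u. (\<And>i. i \<in> J \<Longrightarrow> u i = z i) \<Longrightarrow> image_int \<sigma> u p = image_int \<sigma> z p"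
proof -
  obtain j i where j: "i < length (\<sigma> [z j])" "p = block_start \<sigma> z j + int i"
    using block_cover_nonerasing by metis
  show ?thesis
  proof (rule that[of "{min 0 j..max 0 j}"])
    fix u assume u: "\<And>i. i \<in> {min 0 j..max 0 j} \<Longrightarrow> u i = z i"
    have "block_start \<sigma> u j = block_start \<sigma> z j"
      using u by (intro block_start_cong[OF morphism]) auto
    moreover have "u j = z j" using u by auto
    ultimately show "image_int \<sigma> u p = image_int \<sigma> z p"
      using j image_int_block[OF morphism, of i u j] image_int_block[OF morphism, of i z j] by simp
  qed simp
qed

lemma image_int_eventually:
  assumes "\<And>i. \<forall>\<^sub>F n in sequentially. u n i = z i"
  shows "\<forall>\<^sub>F n in sequentially. image_int \<sigma> (u n) p = image_int \<sigma> z p"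
proof -
  obtain J where J: "finite J" "\<And>v. (\<And>i. i \<in> J \<Longrightarrow> v i = z i) \<Longrightarrow> image_int \<sigma> v p = image_int \<sigma> z p"
    using image_int_local by blast
  have "\<forall>\<^sub>F n in sequentially. \<forall>i\<in>J. u n i = z i"
    using J(1) assms by (intro eventually_ball_finite) auto
  then show ?thesis by eventually_elim (use J(2) in blast)
qed

lemma image_int_before_block:
  "image_int \<sigma> x (block_start \<sigma> x (j + 1) - 1) = last (\<sigma> [x j])"
proof -
  have "0 < length (\<sigma> [x j])" by simp
  then have "block_start \<sigma> x (j + 1) - 1 = block_start \<sigma> x j + int (length (\<sigma> [x j]) - 1)"
    using block_start_step[OF morphism, of x j] by linarith
  then show ?thesis
    using image_int_block[OF morphism, of "length (\<sigma> [x j]) - 1" x j] by (simp add: last_conv_nth)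
qed

text \<open>Subtracting \<open>k\<close> gives coordinates in the represented point. Its origin lies
  in block 0, so block 1 starts at 1 or later, and each further block takes at least one
  position.\<close>

lemma block_start_gt:
  assumes "k < length (\<sigma> [x 0])" "j \<ge> 1"
  shows "block_start \<sigma> x j - int k \<ge> j"
  using block_start_step[OF morphism, of x 0] block_start_diff_ge[of 1 j x]
    block_start_0[OF morphism, of x] assms by simp

lemma common_block_start:
  fixes x x' :: "int \<Rightarrow> 'a"
  assumes k: "k < length (\<sigma> [x 0])" "k' < length (\<sigma> [x' 0])"
    and img: "\<And>p. p \<ge> 0 \<Longrightarrow> image_int \<sigma> x (p + int k) = image_int \<sigma> x' (p + int k')"
    and common: "block_start \<sigma> x (int n + 1) - int k = block_start \<sigma> x' (int n' + 1) - int k'"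
  shows "k = k' \<and> n = n' \<and> (\<forall>i\<le>n. x (int i) = x' (int i))"
proof -
  \<comment> \<open>The letter before the common start has a nonnegative position, so
    \<open>img\<close> applies; being the last letter of a block in both images, it determines that
    block, and removing it gives an earlier common start.\<close>
  have preceding_block: "x (int n) = x' (int n') \<and>
      block_start \<sigma> x (int n) - int k = block_start \<sigma> x' (int n') - int k'"
    if eq: "block_start \<sigma> x (int n + 1) - int k = block_start \<sigma> x' (int n' + 1) - int k'" for n n'
  proof -
    have "last (\<sigma> [x (int n)]) = last (\<sigma> [x' (int n')])"
      using img[of "block_start \<sigma> x (int n + 1) - int k - 1"] eq block_start_gt[of k x "int n + 1"] k(1)
        image_int_before_block[of x "int n"] image_int_before_block[of x' "int n'"]
      by (simp add: algebra_simps)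
    then have "x (int n) = x' (int n')" using marked unfolding right_marked_def by blast
    then show ?thesis
      using eq block_start_step[OF morphism, of x "int n"] block_start_step[OF morphism, of x' "int n'"]
      by simp
  qed
  show ?thesis
    using common
  proof (induction n arbitrary: n')
    case (0 n')
    have x0: "x 0 = x' (int n')" and start: "- int k = block_start \<sigma> x' (int n') - int k'"
      using preceding_block[OF 0] block_start_0[OF morphism, of x] by auto
    \<comment> \<open>Block 0 of \<open>x\<close> starts at \<open>- int k\<close>, which is at most
      0, whereas a block of positive index starts at a positive position.\<close>
    have "n' = 0"
      using start block_start_gt[of k' x' "int n'"] k(2) by (cases n') auto
    then show ?case using x0 start block_start_0[OF morphism, of x'] by simp
  next
    case (Suc n n')
    have last_eq: "x (int (Suc n)) = x' (int n')"
      and start: "block_start \<sigma> x (int (Suc n)) - int k = block_start \<sigma> x' (int n') - int k'"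
      using preceding_block[OF Suc.prems] by auto
    have "n' \<noteq> 0"
      using start block_start_gt[of k x "int (Suc n)"] k(1) block_start_0[OF morphism, of x']
      by (intro notI) simp
    then obtain m where m: "n' = Suc m" by (cases n') auto
    have "k = k' \<and> n = m \<and> (\<forall>i\<le>n. x (int i) = x' (int i))"
      using start by (intro Suc.IH) (simp add: m add_ac)
    then show ?case using last_eq by (auto simp: m le_Suc_eq)
  qed
qed

text \<open>A compactness argument by contradiction. The bound \<open>j' \<ge> 1\<close> excludes
  block 0, which may start left of the origin of the represented point, where nothing is
  known.\<close>

lemma eventually_common_block_start:
  fixes x x' :: "int \<Rightarrow> 'a"
  assumes fin: "finite (UNIV :: 'a set)"
    and shift: "shift_space X" and rec: "recognizable_on \<sigma> X" and X: "x \<in> X" "x' \<in> X"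
    and k: "k < length (\<sigma> [x 0])" "k' < length (\<sigma> [x' 0])"
    and img: "\<And>p. p \<ge> 0 \<Longrightarrow> image_int \<sigma> x (p + int k) = image_int \<sigma> x' (p + int k')"
  obtains j0 where "\<And>j. j \<ge> j0 \<Longrightarrow>
    \<exists>j'\<ge>1. block_start \<sigma> x j - int k = block_start \<sigma> x' j' - int k'"
proof (rule ccontr)
  assume "\<not> thesis"
  \<comment> \<open>The chosen starts move to infinity, so that the known agreement to their left
    grows with \<open>n\<close>.\<close>
  then have "\<exists>j\<ge>int n + 1. \<forall>j'\<ge>1. block_start \<sigma> x j - int k \<noteq> block_start \<sigma> x' j' - int k'" for n
    using that by blast
  then obtain c where c: "\<And>n. c n \<ge> int n + 1"
    "\<And>n j'. j' \<ge> 1 \<Longrightarrow> block_start \<sigma> x (c n) - int k \<noteq> block_start \<sigma> x' j' - int k'"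
    by metis
  have pos: "block_start \<sigma> x (c n) - int k \<ge> int n + 1" for n
    using block_start_gt[of k x "c n"] k c(1)[of n] by linarith
  have "\<exists>j i. i < length (\<sigma> [x' j]) \<and> 0 < i \<and>
    block_start \<sigma> x (c n) - int k + int k' = block_start \<sigma> x' j + int i" for n
  proof -
    have "block_start \<sigma> x' 0 \<le> block_start \<sigma> x (c n) - int k + int k'"
      using pos[of n] by (simp add: block_start_0[OF morphism])
    then obtain j i where j: "j \<ge> 0" "i < length (\<sigma> [x' j])"
      "block_start \<sigma> x (c n) - int k + int k' = block_start \<sigma> x' j + int i"
      by (rule block_cover[OF morphism infinite_image_nat_nonerasing])
    \<comment> \<open>Offset 0 would make the start common, unless \<open>j = 0\<close>; that case
      is excluded because the start lies to the right of the origin.\<close>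
    have "i \<noteq> 0"
    proof
      assume "i = 0"
      then have "j < 1" using j(3) c(2)[of j n] by force
      then have "j = 0" using j(1) by simp
      then show False
        using \<open>i = 0\<close> j(3) pos[of n] block_start_0[OF morphism, of x'] by simp
    qed
    then show ?thesis using j by blast
  qed
  then obtain c' r where r: "\<And>n. r n < length (\<sigma> [x' (c' n)])" "\<And>n. 0 < r n"
    "\<And>n. block_start \<sigma> x (c n) - int k + int k' = block_start \<sigma> x' (c' n) + int (r n)"
    by metis
  define z where "z n = translate (c n) x" for n
  define z' where "z' n = translate (c' n) x'" for n
  have zimg: "image_int \<sigma> (z n) p = image_int \<sigma> (z' n) (p + int (r n))" if "p \<ge> - int n" for n p
  proof -
    have "image_int \<sigma> (z n) p = image_int \<sigma> x (p + block_start \<sigma> x (c n))"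
      by (simp add: z_def image_int_translate_nonerasing)
    also have "\<dots> = image_int \<sigma> x' (p + block_start \<sigma> x (c n) - int k + int k')"
      using img[of "p + block_start \<sigma> x (c n) - int k"] pos[of n] that by simp
    also have "p + block_start \<sigma> x (c n) - int k + int k'
      = p + int (r n) + block_start \<sigma> x' (c' n)"
      using r(3)[of n] by simp
    finally show ?thesis by (simp add: z'_def image_int_translate_nonerasing)
  qed
  \<comment> \<open>Bundling both sequences with the offset yields one subsequence for all three;
    the offsets are bounded because there are finitely many blocks.\<close>
  define f where "f n i = (z n i, z' n i, r n)" for n i
  have "finite (range (\<lambda>n. f n i))" for i
  proof (rule finite_subset)
    show "range (\<lambda>n. f n i) \<subseteq> UNIV \<times> UNIV \<times> (\<Union>a. {..<length (\<sigma> [a])})"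
      using r(1) by (auto simp: f_def)
    show "finite ((UNIV :: 'a set) \<times> (UNIV :: 'a set) \<times> (\<Union>a. {..<length (\<sigma> [a])}))"
      using fin by auto
  qed
  then obtain s g where s: "strict_mono s" and g: "\<And>i. \<forall>\<^sub>F n in sequentially. f (s n) i = g i"
    by (rule pointwise_convergent_subsequence[of f]) blast
  define w where "w i = fst (g i)" for i
  define w' where "w' i = fst (snd (g i))" for i
  define l where "l = snd (snd (g 0))"
  have lim: "\<forall>\<^sub>F n in sequentially. z (s n) i = w i" "\<forall>\<^sub>F n in sequentially. z' (s n) i = w' i" for i
    using g[of i] by (auto simp: f_def w_def w'_def elim!: eventually_mono) (metis fst_conv snd_conv)+
  have liml: "\<forall>\<^sub>F n in sequentially. r (s n) = l"
    using g[of 0] by (auto simp: f_def l_def elim!: eventually_mono) (metis snd_conv)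
  have limX: "u \<in> X" if "\<And>n. v n \<in> X" "\<And>i. \<forall>\<^sub>F n in sequentially. v n i = u i" for u v
  proof (rule shift_space_memI[OF shift])
    fix J :: "int set" assume "finite J"
    then have "\<forall>\<^sub>F n in sequentially. \<forall>i\<in>J. v n i = u i"
      using that(2) by (intro eventually_ball_finite) auto
    then show "\<exists>v\<in>X. \<forall>i\<in>J. v i = u i"
      using that(1) by (auto simp: eventually_sequentially)
  qed
  have "w \<in> X"
    by (rule limX[of "\<lambda>n. z (s n)"])
      (use lim X shift_space_translate[OF shift] in \<open>auto simp: z_def\<close>)
  have "w' \<in> X"
    by (rule limX[of "\<lambda>n. z' (s n)"])
      (use lim X shift_space_translate[OF shift] in \<open>auto simp: z'_def\<close>)
  have "\<forall>\<^sub>F n in sequentially. 0 < l \<and> l < length (\<sigma> [w' 0])"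
    using liml lim(2)[of 0]
  proof eventually_elim
    case (elim n)
    then show ?case using r(1,2)[of "s n"] by (simp add: z'_def translate_apply)
  qed
  then have l: "0 < l" "l < length (\<sigma> [w' 0])" by auto
  have wimg: "image_int \<sigma> w p = image_int \<sigma> w' (p + int l)" for p
  proof -
    have "\<forall>\<^sub>F n in sequentially. image_int \<sigma> (z (s n)) p = image_int \<sigma> w p"
      by (rule image_int_eventually) (rule lim)
    moreover have "\<forall>\<^sub>F n in sequentially. image_int \<sigma> (z' (s n)) (p + int l) = image_int \<sigma> w' (p + int l)"
      by (rule image_int_eventually) (rule lim)
    moreover have "\<forall>\<^sub>F n in sequentially. nat (- p) \<le> n"
      by (rule eventually_ge_at_top)
    ultimately have "\<forall>\<^sub>F n in sequentially. image_int \<sigma> w p = image_int \<sigma> w' (p + int l)"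
      using liml
    proof eventually_elim
      case (elim n)
      \<comment> \<open>The images agree from \<open>- int (s n)\<close> on, so every fixed
        \<open>p\<close> is eventually covered.\<close>
      have "n \<le> s n" using s by (rule strict_mono_imp_increasing)
      then show ?case using elim zimg[of "s n" p] by simp
    qed
    then show ?thesis by simp
  qed
  have "representation_int \<sigma> (image_int \<sigma> w) (w, 0)"
    "representation_int \<sigma> (image_int \<sigma> w) (w', l)"
    using l wimg infinite_image_int_nonerasing by (auto simp: representation_int_iff[OF morphism])
  then have "(w, 0) = (w', l)"
    using rec \<open>w \<in> X\<close> \<open>w' \<in> X\<close> unfolding recognizable_on_def Uniq_def by (metis fst_conv)
  with l(1) show False by simp
qed

lemma one_sided_of_recognizable:
  assumes fin: "finite (UNIV :: 'a set)"
    and shift: "shift_space X" and rec: "recognizable_on \<sigma> X"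
  shows "one_sided_recognizable_on \<sigma> (pos_part ` X)"
proof -
  have "pos_part x = pos_part x' \<and> k = k'"
    if X: "x \<in> X" "x' \<in> X" and rep: "representation_nat \<sigma> y (pos_part x, k)"
      "representation_nat \<sigma> y (pos_part x', k')" for x x' y k k'
  proof -
    note R = rep[unfolded representation_nat_pos_part[OF morphism]]
    have k: "k < length (\<sigma> [x 0])" "k' < length (\<sigma> [x' 0])" using R by auto
    have img: "image_int \<sigma> x (p + int k) = image_int \<sigma> x' (p + int k')" if "p \<ge> 0" for p
      using R that by (metis nat_0_le)
    obtain j0 where j0: "\<And>j. j \<ge> j0 \<Longrightarrow>
        \<exists>j'\<ge>1. block_start \<sigma> x j - int k = block_start \<sigma> x' j' - int k'"
      using eventually_common_block_start[OF fin shift rec X k img] by blast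
    have "k = k' \<and> x (int i) = x' (int i)" for i
    proof -
      \<comment> \<open>Large enough to include \<open>i\<close> and to make block
        \<open>n + 1\<close> start at a common position.\<close>
      define n where "n = max i (nat j0)"
      have "int n + 1 \<ge> j0" by (simp add: n_def)
      then obtain j' where j': "j' \<ge> 1"
        "block_start \<sigma> x (int n + 1) - int k = block_start \<sigma> x' j' - int k'"
        using j0 by blast
      then have "k = k' \<and> (\<forall>i\<le>n. x (int i) = x' (int i))"
        \<comment> \<open>\<open>common_block_start\<close> names a common start by the block ending
          there, hence \<open>j' - 1\<close>.\<close>
        using common_block_start[OF k img, of n "nat (j' - 1)"] by simp
      then show ?thesis by (simp add: n_def)
    qed
    then show ?thesis by (auto simp: pos_part_def)
  qed
  then show ?thesis
    unfolding one_sided_recognizable_on_def Uniq_def by (auto simp: image_iff)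
qed

end

theorem proposition4p1:
  fixes \<sigma> :: "'a::finite list \<Rightarrow> 'b::finite list" and X :: "(int \<Rightarrow> 'a) set"
  assumes "word_morphism \<sigma>" and "shift_space X"
  shows "(one_sided_recognizable_on \<sigma> (pos_part ` X) \<longrightarrow> recognizable_on \<sigma> X) \<and>
         (right_marked \<sigma> \<and> recognizable_on \<sigma> X \<longrightarrow> one_sided_recognizable_on \<sigma> (pos_part ` X))"
  using recognizable_of_one_sided[OF assms] one_sided_of_recognizable[OF assms(1) _ _ assms(2)]
  by auto

end
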